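(* In every interior equilibrium $h$, the ex-ante expected price is weakly above its rational-expectations-equilibrium level: $$\sum_{\theta\in\Theta}\mu(\theta)h(\theta)\ \ge\ v^*+\Delta-\bar S .$$
   Context: Primitives: $\Theta=\Theta_1\times\cdots\times\Theta_n$ is a finite set of states; $\mu$ is a full-support probability distribution on $\Theta$; $S:\Theta\to(0,\infty)$ is one-to-one; $\bar S=\sum_\theta\mu(\theta)S(\theta)$; $v^*,c$ are real numbers with $\Delta=v^*-c>0$; $\mathcal{M}$ is a finite nonempty collection of subsets of $\{1,\dots,n\}$ (consumers' cognitive types). For $M\subseteq\{1,\dots,n\}$ write $\theta_M=(\theta_i)_{i\in M}$, and let $\mu(\theta'\mid\theta'_M=\theta_M)$ be $\mu(\theta')/\sum_{\theta'':\theta''_M=\theta_M}\mu(\theta'')$ if $\theta'_M=\theta_M$, and $0$ otherwise. Firms have types $\pi\sim U[0,1]$; a type-$\pi$ firm is active at state $\theta$ and price $\phi$ iff $\phi-c+\pi S(\theta)\ge0$, and its add-on is $\pi S(\theta)$. Let $\pi^\star(\theta,\phi)=(c-\phi)/S(\theta)$ be the marginal type. For a price function $h:\Theta\to\mathbb{R}$, the expected add-on among active firms in state $\theta$ is $\bar q(\theta)=\frac{1+\pi^\star(\theta,h(\theta))}{2}S(\theta)$. Equilibrium (homogeneous-preference limit, in which all consumers' bare valuation is $v^*$ and equilibrium prices are taken to be fully revealing): $h:\Theta\to\mathbb{R}$ is an interior equilibrium if for every $\theta$, $\pi^\star(\theta,h(\theta))\in(0,1)$ and $$h(\theta)=v^*-\min_{M\in\mathcal{M}}\sum_{\theta'}\mu(\theta'\mid\theta'_M=\theta_M)\,\bar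 q(\theta').$$ The rational-expectations equilibrium is the case $\mathcal{M}=\{\{1,\dots,n\}\}$, in which $h(\theta)=v^*+\Delta-S(\theta)$. *)

theory Defs
  imports "HOL-Probability.Probability"
begin

text \<open>
  A state is a function on \<open>{1..n}\<close> whose \<open>i\<close>-th component lies in the finite set \<open>\<Theta> i\<close>, and
  \<open>restrict \<theta> M\<close> is the subvector of \<open>\<theta>\<close> with indices in \<open>M\<close>. A common component type
  \<open>'a\<close> loses no generality, since finitely many finite sets embed into a single type.
\<close>

definition states :: "nat \<Rightarrow> (nat \<Rightarrow> 'a set) \<Rightarrow> (nat \<Rightarrow> 'a) set" where
  "states n \<Theta> = (\<Pi>\<^sub>E i\<in>{1..n}. \<Theta> i)"

text \<open>\<open>cond_prob X \<mu> M \<theta> \<theta>'\<close> is the probability of \<open>\<theta>'\<close> given that the \<open>M\<close>-components are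
  those of \<open>\<theta>\<close>.\<close>

definition cond_prob ::
  "(nat \<Rightarrow> 'a) set \<Rightarrow> (nat \<Rightarrow> 'a) pmf \<Rightarrow> nat set \<Rightarrow> (nat \<Rightarrow> 'a) \<Rightarrow> (nat \<Rightarrow> 'a) \<Rightarrow> real" where
  "cond_prob X \<mu> M \<theta> \<theta>' =
     (if restrict \<theta>' M = restrict \<theta> M
      then pmf \<mu> \<theta>' / (\<Sum>\<theta>''\<in>{\<theta>''\<in>X. restrict \<theta>'' M = restrict \<theta> M}. pmf \<mu> \<theta>'')
      else 0)"

definition active_types :: "real \<Rightarrow> ('s \<Rightarrow> real) \<Rightarrow> 's \<Rightarrow> real \<Rightarrow> real set" where
  "active_types c S \<theta> \<phi> = {\<pi>\<in>{0..1}. \<phi> - c + \<pi> * S \<theta> \<ge> 0}"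

definition marginal_type :: "real \<Rightarrow> ('s \<Rightarrow> real) \<Rightarrow> 's \<Rightarrow> real \<Rightarrow> real" where
  "marginal_type c S \<theta> \<phi> = (c - \<phi>) / S \<theta>"

definition expected_add_on :: "real \<Rightarrow> ('s \<Rightarrow> real) \<Rightarrow> ('s \<Rightarrow> real) \<Rightarrow> 's \<Rightarrow> real" where
  "expected_add_on c S h \<theta> = (1 + marginal_type c S \<theta> (h \<theta>)) / 2 * S \<theta>"

text \<open>At an interior marginal type, \<open>expected_add_on\<close> is the mean of \<open>\<pi> * S \<theta>\<close> for \<open>\<pi>\<close> uniform on
  \<open>{0..1}\<close>, conditional on the firm being active.\<close>

lemma active_types_eq:
  assumes "S \<theta> > 0" "marginal_type c S \<theta> \<phi> \<in> {0<..<1}"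
  shows "active_types c S \<theta> \<phi> = {marginal_type c S \<theta> \<phi>..1}"
proof -
  have *: "\<phi> - c + \<pi> * S \<theta> \<ge> 0 \<longleftrightarrow> marginal_type c S \<theta> \<phi> \<le> \<pi>" for \<pi>
    unfolding marginal_type_def pos_divide_le_eq[OF assms(1)] by linarith
  have "0 \<le> marginal_type c S \<theta> \<phi>"
    using assms(2) by simp
  then show ?thesis
    unfolding active_types_def * by auto
qed

lemma expected_add_on_eq:
  assumes "S \<theta> > 0" "marginal_type c S \<theta> (h \<theta>) \<in> {0<..<1}"
  defines "A \<equiv> active_types c S \<theta> (h \<theta>)"
  defines "U \<equiv> uniform_measure lborel {0..1::real}"
  shows "expected_add_on c S h \<theta> = (LINT \<pi>:A|U. \<pi> * S \<theta>) / measure U A"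
proof -
  define p where "p = marginal_type c S \<theta> (h \<theta>)"
  have p: "0 < p" "p < 1" using assms(2) by (auto simp: p_def)
  have A: "A = {p..1}"
    unfolding A_def p_def using assms(1,2) by (rule active_types_eq)
  have sub: "{0..1} \<inter> {p..1} = {p..1}" using p by auto
  have measure: "measure U {p..1} = 1 - p"
    using p by (simp add: U_def sub)
  have U: "U = density lborel (\<lambda>x. ennreal (indicator {0..1} x))"
    unfolding U_def uniform_measure_def by (simp add: ennreal_indicator divide_ennreal_def)
  have "(LINT \<pi>:{p..1}|U. \<pi> * S \<theta>) = (LINT x:{p..1}|lborel. x * S \<theta>)"
    unfolding U set_lebesgue_integral_def
    by (subst integral_density)
      (use p in \<open>auto intro!: Bochner_Integration.integral_cong simp: indicator_def\<close>)
  also have "\<dots> = (\<integral>x. x * S \<theta> * indicator {p..1} x \<partial>lborel)"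
    unfolding set_lebesgue_integral_def by (simp add: mult_ac)
  also have "\<dots> = 1\<^sup>2 / 2 * S \<theta> - p\<^sup>2 / 2 * S \<theta>"
    by (intro integral_FTC_Icc_real) (use p in \<open>auto intro!: derivative_eq_intros\<close>)
  also have "\<dots> = (1 - p) * ((1 + p) / 2 * S \<theta>)"
    by (simp add: field_simps power2_eq_square)
  finally have "(LINT \<pi>:{p..1}|U. \<pi> * S \<theta>) = (1 - p) * ((1 + p) / 2 * S \<theta>)" .
  then have "(LINT \<pi>:{p..1}|U. \<pi> * S \<theta>) / (1 - p) = (1 + p) / 2 * S \<theta>"
    using p by (simp only: nonzero_mult_div_cancel_left)
  then show ?thesis
    unfolding A measure expected_add_on_def p_def[symmetric] by (rule sym)
qed

text \<open>Only the values of \<open>h\<close> on the set \<open>X\<close> of states matter; \<open>\<M>\<close> is the collection of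
  cognitive types and \<open>v\<close> the common bare valuation.\<close>

definition interior_equilibrium ::
  "(nat \<Rightarrow> 'a) set \<Rightarrow> (nat \<Rightarrow> 'a) pmf \<Rightarrow> ((nat \<Rightarrow> 'a) \<Rightarrow> real) \<Rightarrow> real \<Rightarrow> real \<Rightarrow> nat set set
    \<Rightarrow> ((nat \<Rightarrow> 'a) \<Rightarrow> real) \<Rightarrow> bool" where
  "interior_equilibrium X \<mu> S v c \<M> h \<longleftrightarrow>
     (\<forall>\<theta>\<in>X. marginal_type c S \<theta> (h \<theta>) \<in> {0<..<1} \<and>
        h \<theta> = v - Min ((\<lambda>M. \<Sum>\<theta>'\<in>X. cond_prob X \<mu> M \<theta> \<theta>' * expected_add_on c S h \<theta>') ` \<M>))"

text \<open>The rational-expectations case: the sole cognitive type observes every component.\<close>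

lemma rational_expectations_price:
  assumes "\<And>i. i \<in> {1..n} \<Longrightarrow> finite (\<Theta> i)"
    and "set_pmf \<mu> = states n \<Theta>"
    and "\<And>\<theta>. \<theta> \<in> states n \<Theta> \<Longrightarrow> S \<theta> > 0"
    and "interior_equilibrium (states n \<Theta>) \<mu> S v c {{1..n}} h"
    and "\<theta> \<in> states n \<Theta>"
  shows "h \<theta> = v + (v - c) - S \<theta>"
proof -
  let ?X = "states n \<Theta>"
  have fin: "finite ?X"
    unfolding states_def using assms(1) by (intro finite_PiE) auto
  have restr: "restrict \<theta>' {1..n} = \<theta>'" if "\<theta>' \<in> ?X" for \<theta>'
    using that unfolding states_def by (rule PiE_restrict)
  have "{\<theta>''\<in>?X. restrict \<theta>'' {1..n} = restrict \<theta> {1..n}} = {\<theta>}"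
    using restr assms(5) by auto
  moreover have "pmf \<mu> \<theta> \<noteq> 0"
    using assms(2,5) by (metis set_pmf_iff)
  ultimately have cp: "cond_prob ?X \<mu> {1..n} \<theta> \<theta>' = (if \<theta>' = \<theta> then 1 else 0)" if "\<theta>' \<in> ?X" for \<theta>'
    using that restr assms(5) by (simp add: cond_prob_def)
  have "(\<Sum>\<theta>'\<in>?X. cond_prob ?X \<mu> {1..n} \<theta> \<theta>' * expected_add_on c S h \<theta>')
      = (\<Sum>\<theta>'\<in>?X. if \<theta>' = \<theta> then expected_add_on c S h \<theta>' else 0)"
    by (rule sum.cong[OF refl]) (simp only: cp, simp)
  also have "\<dots> = expected_add_on c S h \<theta>"
    using fin assms(5) by simp
  finally have "h \<theta> = v - expected_add_on c S h \<theta>"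
    using assms(4,5) by (simp add: interior_equilibrium_def)
  moreover have "expected_add_on c S h \<theta> = (S \<theta> + c - h \<theta>) / 2"
  proof -
    have "marginal_type c S \<theta> (h \<theta>) * S \<theta> = c - h \<theta>"
      using assms(3)[OF assms(5)] by (simp add: marginal_type_def)
    then show ?thesis
      by (simp add: expected_add_on_def distrib_right)
  qed
  ultimately show ?thesis by argo
qed

end

theory Submission
  imports Defs
begin

text \<open>
  Whichever cognitive type attains the minimum in a state, the price is at least \<open>v\<close> minus the
  add-on expected by one fixed \<open>M\<close>. Averaging over states, the law of total expectation turns the
  conditional expectation of the add-on into its mean, which is \<open>(S_bar + c - H) / 2\<close>
  with \<open>H\<close> the mean price and \<open>S_bar\<close> the mean of \<open>S\<close>. So
  \<open>H \<ge> v - (S_bar + c - H) / 2\<close>, and this rearranges to the claim.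
\<close>

text \<open>The factor \<open>S \<theta>\<close> cancels the denominator of the marginal type, so
  the add-on is affine in the price and its mean depends only on the means of \<open>S\<close> and
  \<open>h\<close>.\<close>

lemma expected_add_on_conv:
  assumes "S \<theta> \<noteq> 0"
  shows "expected_add_on c S h \<theta> = (S \<theta> + c - h \<theta>) / 2"
  using assms by (simp add: expected_add_on_def marginal_type_def field_simps)

text \<open>Only states agreeing with \<open>\<theta>'\<close> on \<open>M\<close> contribute. On
  that class the conditional probability is constant in \<open>\<theta>\<close>, and the weights add
  up to its denominator.\<close>

lemma sum_cond_prob_left:
  assumes "finite X" and "\<theta>' \<in> X" and "pmf \<mu> \<theta>' \<noteq> 0"
  shows "(\<Sum>\<theta>\<in>X. pmf \<mu> \<theta> * cond_prob X \<mu> M \<theta> \<theta>') = pmf \<mu> \<theta>'"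
proof -
  define C where "C = {\<theta>\<in>X. restrict \<theta> M = restrict \<theta>' M}"
  \<comment> \<open>The class contains \<open>\<theta>'\<close> itself, so its mass is nonzero and
    can be cancelled below.\<close>
  have "pmf \<mu> \<theta>' \<le> sum (pmf \<mu>) C"
    using assms by (intro member_le_sum) (auto simp: C_def)
  with assms(3) have pos: "sum (pmf \<mu>) C \<noteq> 0"
    by (smt (verit) pmf_nonneg)
  have "(\<Sum>\<theta>\<in>X. pmf \<mu> \<theta> * cond_prob X \<mu> M \<theta> \<theta>')
      = (\<Sum>\<theta>\<in>C. pmf \<mu> \<theta> * cond_prob X \<mu> M \<theta> \<theta>')"
    using assms(1) by (intro sum.mono_neutral_right) (auto simp: C_def cond_prob_def)
  \<comment> \<open>Every \<open>\<theta>\<close> in \<open>C\<close> has the same conditioning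
    class, namely \<open>C\<close>.\<close>
  also have "\<dots> = (\<Sum>\<theta>\<in>C. pmf \<mu> \<theta> * (pmf \<mu> \<theta>' / sum (pmf \<mu>) C))"
    by (intro sum.cong) (auto simp: C_def cond_prob_def)
  also have "\<dots> = pmf \<mu> \<theta>'"
    using pos by (simp flip: sum_distrib_right sum_divide_distrib)
  finally show ?thesis .
qed

text \<open>After exchanging the sums, averaging over the conditioning state returns the prior
  weight of \<open>\<theta>'\<close>.\<close>

lemma total_expectation_cond_prob:
  assumes "finite X" and "\<And>\<theta>. \<theta> \<in> X \<Longrightarrow> pmf \<mu> \<theta> \<noteq> 0"
  shows "(\<Sum>\<theta>\<in>X. pmf \<mu> \<theta> * (\<Sum>\<theta>'\<in>X. cond_prob X \<mu> M \<theta> \<theta>' * f \<theta>'))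
    = (\<Sum>\<theta>\<in>X. pmf \<mu> \<theta> * f \<theta>)"
proof -
  have "(\<Sum>\<theta>\<in>X. pmf \<mu> \<theta> * (\<Sum>\<theta>'\<in>X. cond_prob X \<mu> M \<theta> \<theta>' * f \<theta>'))
      = (\<Sum>\<theta>'\<in>X. (\<Sum>\<theta>\<in>X. pmf \<mu> \<theta> * cond_prob X \<mu> M \<theta> \<theta>') * f \<theta>')"
    unfolding sum_distrib_left sum_distrib_right mult.assoc by (rule sum.swap)
  also have "\<dots> = (\<Sum>\<theta>\<in>X. pmf \<mu> \<theta> * f \<theta>)"
    using assms by (intro sum.cong) (simp_all add: sum_cond_prob_left)
  finally show ?thesis .
qed

theorem corollary1:
  fixes n :: nat
    and \<Theta> :: "nat \<Rightarrow> 'a set"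
    and \<mu> :: "(nat \<Rightarrow> 'a) pmf"
    and S :: "(nat \<Rightarrow> 'a) \<Rightarrow> real"
    and v c \<Delta> :: real
    and \<M> :: "nat set set"
    and h :: "(nat \<Rightarrow> 'a) \<Rightarrow> real"
  assumes "\<And>i. i \<in> {1..n} \<Longrightarrow> finite (\<Theta> i)"
    and "set_pmf \<mu> = states n \<Theta>"
    and "\<And>\<theta>. \<theta> \<in> states n \<Theta> \<Longrightarrow> S \<theta> > 0"
    and "inj_on S (states n \<Theta>)"
    and "\<Delta> = v - c" and "\<Delta> > 0"
    and "finite \<M>" and "\<M> \<noteq> {}" and "\<M> \<subseteq> Pow {1..n}"
    and "interior_equilibrium (states n \<Theta>) \<mu> S v c \<M> h"
  shows "(\<Sum>\<theta>\<in>states n \<Theta>. pmf \<mu> \<theta> * h \<theta>)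
           \<ge> v + \<Delta> - (\<Sum>\<theta>\<in>states n \<Theta>. pmf \<mu> \<theta> * S \<theta>)"
proof -
  let ?X = "states n \<Theta>"
  let ?E = "\<lambda>f. \<Sum>\<theta>\<in>?X. pmf \<mu> \<theta> * f \<theta>"
  let ?q = "expected_add_on c S h"
  have fin: "finite ?X"
    unfolding states_def using assms(1) by (intro finite_PiE) auto
  have pmf: "pmf \<mu> \<theta> \<noteq> 0" if "\<theta> \<in> ?X" for \<theta>
    using that assms(2) by (metis set_pmf_iff)
  have one: "?E (\<lambda>_. a) = a" for a
    using sum_pmf_eq_1[OF fin, of \<mu>] assms(2) by (simp flip: sum_distrib_right)
  obtain M where M: "M \<in> \<M>"
    using assms(8) by blast
  \<comment> \<open>\<open>Min\<close> is at most the value at \<open>M\<close>, even in states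
    where another type attains it.\<close>
  have "h \<theta> \<ge> v - (\<Sum>\<theta>'\<in>?X. cond_prob ?X \<mu> M \<theta> \<theta>' * ?q \<theta>')" if "\<theta> \<in> ?X" for \<theta>
    using assms(7,10) that M by (simp add: interior_equilibrium_def)
  then have "?E h \<ge> ?E (\<lambda>\<theta>. v - (\<Sum>\<theta>'\<in>?X. cond_prob ?X \<mu> M \<theta> \<theta>' * ?q \<theta>'))"
    by (intro sum_mono mult_left_mono) auto
  also have "?E (\<lambda>\<theta>. v - (\<Sum>\<theta>'\<in>?X. cond_prob ?X \<mu> M \<theta> \<theta>' * ?q \<theta>')) = v - ?E ?q"
    using one[of v] total_expectation_cond_prob[OF fin pmf, of M ?q]
    by (simp add: right_diff_distrib sum_subtractf)
  finally have "?E h \<ge> v - ?E ?q" .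
  moreover have "?E ?q = (?E S + c - ?E h) / 2"
  proof -
    have "?E ?q = ?E (\<lambda>\<theta>. (S \<theta> + c - h \<theta>) / 2)"
      by (intro sum.cong refl arg_cong2[where f = "(*)"] expected_add_on_conv)
        (use assms(3) in force)
    also have "\<dots> = (?E S + ?E (\<lambda>_. c) - ?E h) / 2"
      by (simp add: algebra_simps sum.distrib sum_subtractf flip: sum_divide_distrib)
    finally show ?thesis
      unfolding one .
  qed
  \<comment> \<open>Collecting \<open>?E h\<close> leaves half of it on the left; doubling gives
    \<open>2 * v - c\<close>, which is \<open>v + \<Delta>\<close>.\<close>
  ultimately show ?thesis
    using assms(5) by argo
qed

end
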